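(* Let $m\in\mathbb N$, $G:=(\mathbb Z_2)^{2m}$, and let $A_m$ be the index-twisted algebra, i.e. the real vector space with basis $\{B(\alpha,\beta):(\alpha,\beta)\in G\}$, $\alpha,\beta\in(\mathbb Z_2)^m$, and multiplication $$B(\alpha,\beta)\,B(\alpha',\beta')=(-1)^{\beta\cdot\alpha'}\,B(\alpha+\alpha',\beta+\beta').$$ Declare $B(\alpha,\beta)$ to be homogeneous of degree $(\alpha,\beta)\in G$. Define $\Omega:G\times G\to\mathbb Z_2$ by $$\Omega\big((\alpha,\beta),(\alpha',\beta')\big):=\beta\cdot\alpha'+\beta'\cdot\alpha \pmod 2$$ and set $\varepsilon(g,h):=(-1)^{\Omega(g,h)}\in\{\pm1\}$. Then: 1. $A_m$ is a $G$-graded associative algebra with one-dimensional homogeneous components: $A_m=\bigoplus_{g\in G}(A_m)_g$ with $(A_m)_{(\alpha,\beta)}:=\mathbb R\,B(\alpha,\beta)$, and $(A_m)_g(A_m)_h\subseteq(A_m)_{g+h}$. 2. $\varepsilon$ is a bicharacter on $G$. 3. The $\varepsilon$-commutator $[X,Y]_\varepsilon:=XY-\varepsilon(g,h)\,YX$, for $X\in(A_m)_g$, $Y\in(A_m)_h$ (extended bilinearly), turns $A_m$ into a $(G,\varepsilon)$-color Lie algebra.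
   Context: Addition in $(\mathbb Z_2)^m$ and in $G$ is componentwise modulo $2$, and $\beta\cdot\alpha':=\sum_{i=1}^m\beta_i\alpha'_i\in\mathbb Z_2$. A bicharacter on an abelian group $G$ is a map $\varepsilon:G\times G\to\{\pm1\}$ with $\varepsilon(g+h,k)=\varepsilon(g,k)\varepsilon(h,k)$ and $\varepsilon(g,h+k)=\varepsilon(g,h)\varepsilon(g,k)$. A $G$-graded associative algebra $A=\bigoplus_{g\in G}A_g$ (with $A_gA_h\subseteq A_{g+h}$) with the bracket $[x,y]_\varepsilon:=xy-\varepsilon(g,h)yx$ ($x\in A_g$, $y\in A_h$) is a $(G,\varepsilon)$-color Lie algebra if the bracket is bilinear, satisfies $[x,y]_\varepsilon=-\varepsilon(g,h)[y,x]_\varepsilon$, and satisfies the $\varepsilon$-Jacobi identity $$\varepsilon(k,g)[x,[y,z]_\varepsilon]_\varepsilon+\varepsilon(g,h)[y,[z,x]_\varepsilon]_\varepsilon+\varepsilon(h,k)[z,[x,y]_\varepsilon]_\varepsilon=0$$ for all $x\in A_g$, $y\in A_h$, $z\in A_k$. *)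

theory Defs
  imports Complex_Main "HOL-Library.Z2" "HOL-Library.Function_Algebras"
    "HOL-Library.Product_Plus" "HOL-Library.Poly_Mapping"
begin

section \<open>Graded algebras and color Lie algebras\<close>

text \<open>
  Groups, algebras and their homogeneous components are subsets of ambient types, so that
  they may depend on a natural number.
\<close>

definition additive_subgroup :: "'g::ab_group_add set \<Rightarrow> bool" where
  "additive_subgroup G \<longleftrightarrow> 0 \<in> G \<and> (\<forall>g\<in>G. \<forall>h\<in>G. g + h \<in> G) \<and> (\<forall>g\<in>G. - g \<in> G)"

definition bicharacter :: "'g::ab_group_add set \<Rightarrow> ('g \<Rightarrow> 'g \<Rightarrow> real) \<Rightarrow> bool" where
  "bicharacter G \<epsilon> \<longleftrightarrow>
     additive_subgroup G \<and>
     (\<forall>g\<in>G. \<forall>h\<in>G. \<epsilon> g h \<in> {1, -1}) \<and>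
     (\<forall>g\<in>G. \<forall>h\<in>G. \<forall>k\<in>G. \<epsilon> (g + h) k = \<epsilon> g k * \<epsilon> h k) \<and>
     (\<forall>g\<in>G. \<forall>h\<in>G. \<forall>k\<in>G. \<epsilon> g (h + k) = \<epsilon> g h * \<epsilon> g k)"

definition bilinear_on :: "'v::real_vector set \<Rightarrow> ('v \<Rightarrow> 'v \<Rightarrow> 'v) \<Rightarrow> bool" where
  "bilinear_on A f \<longleftrightarrow>
     (\<forall>x\<in>A. \<forall>y\<in>A. f x y \<in> A) \<and>
     (\<forall>x\<in>A. \<forall>y\<in>A. \<forall>z\<in>A. f (x + y) z = f x z + f y z) \<and>
     (\<forall>x\<in>A. \<forall>y\<in>A. \<forall>z\<in>A. f x (y + z) = f x y + f x z) \<and>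
     (\<forall>c. \<forall>x\<in>A. \<forall>y\<in>A. f (c *\<^sub>R x) y = c *\<^sub>R f x y) \<and>
     (\<forall>c. \<forall>x\<in>A. \<forall>y\<in>A. f x (c *\<^sub>R y) = c *\<^sub>R f x y)"

text \<open>Algebras are not required to be unital.\<close>

definition associative_algebra :: "'v::real_vector set \<Rightarrow> ('v \<Rightarrow> 'v \<Rightarrow> 'v) \<Rightarrow> bool" where
  "associative_algebra A mult \<longleftrightarrow>
     subspace A \<and> bilinear_on A mult \<and>
     (\<forall>x\<in>A. \<forall>y\<in>A. \<forall>z\<in>A. mult (mult x y) z = mult x (mult y z))"

text \<open>
  The family \<open>f\<close> writes \<open>x\<close> as a finite sum of elements \<open>f g \<in> V g\<close>. Fixing \<open>f\<close> to be zero
  outside \<open>G\<close> makes uniqueness of \<open>f\<close> as a function the same as uniqueness of the summands.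
\<close>

definition decomposition :: "'g set \<Rightarrow> ('g \<Rightarrow> 'v::real_vector set) \<Rightarrow> 'v \<Rightarrow> ('g \<Rightarrow> 'v) \<Rightarrow> bool" where
  "decomposition G V x f \<longleftrightarrow>
     (\<forall>g\<in>G. f g \<in> V g) \<and> (\<forall>g. g \<notin> G \<longrightarrow> f g = 0) \<and>
     finite {g. f g \<noteq> 0} \<and> x = (\<Sum>g | f g \<noteq> 0. f g)"

definition internal_direct_sum :: "'g set \<Rightarrow> ('g \<Rightarrow> 'v::real_vector set) \<Rightarrow> 'v set \<Rightarrow> bool" where
  "internal_direct_sum G V A \<longleftrightarrow>
     subspace A \<and> (\<forall>g\<in>G. subspace (V g) \<and> V g \<subseteq> A) \<and> (\<forall>x\<in>A. \<exists>!f. decomposition G V x f)"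

definition graded_algebra ::
  "'g::ab_group_add set \<Rightarrow> 'v::real_vector set \<Rightarrow> ('g \<Rightarrow> 'v set) \<Rightarrow> ('v \<Rightarrow> 'v \<Rightarrow> 'v) \<Rightarrow> bool" where
  "graded_algebra G A V mult \<longleftrightarrow>
     additive_subgroup G \<and> associative_algebra A mult \<and> internal_direct_sum G V A \<and>
     (\<forall>g\<in>G. \<forall>h\<in>G. \<forall>x\<in>V g. \<forall>y\<in>V h. mult x y \<in> V (g + h))"

definition homogeneous_part :: "'g set \<Rightarrow> ('g \<Rightarrow> 'v::real_vector set) \<Rightarrow> 'v \<Rightarrow> 'g \<Rightarrow> 'v" where
  "homogeneous_part G V x = (THE f. decomposition G V x f)"

text \<open>
  The bilinear extension of \<open>(x, y) \<mapsto> x y - \<epsilon>(g, h) y x\<close> (\<open>x\<close> of degree \<open>g\<close>, \<open>y\<close> of degree \<open>h\<close>)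
  from homogeneous elements to all of a graded algebra.
\<close>

definition color_commutator ::
  "'g set \<Rightarrow> ('g \<Rightarrow> 'g \<Rightarrow> real) \<Rightarrow> ('g \<Rightarrow> 'v::real_vector set) \<Rightarrow> ('v \<Rightarrow> 'v \<Rightarrow> 'v) \<Rightarrow> 'v \<Rightarrow> 'v \<Rightarrow> 'v" where
  "color_commutator G \<epsilon> V mult x y =
     (let p = homogeneous_part G V x; q = homogeneous_part G V y in
       \<Sum>g | p g \<noteq> 0. \<Sum>h | q h \<noteq> 0. mult (p g) (q h) - \<epsilon> g h *\<^sub>R mult (q h) (p g))"

definition color_lie_algebra ::
  "'g::ab_group_add set \<Rightarrow> ('g \<Rightarrow> 'g \<Rightarrow> real) \<Rightarrow> 'v::real_vector set \<Rightarrow> ('g \<Rightarrow> 'v set) \<Rightarrow>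
   ('v \<Rightarrow> 'v \<Rightarrow> 'v) \<Rightarrow> bool" where
  "color_lie_algebra G \<epsilon> A V mult \<longleftrightarrow>
     graded_algebra G A V mult \<and> bicharacter G \<epsilon> \<and>
     (let br = color_commutator G \<epsilon> V mult in
       bilinear_on A br \<and>
       (\<forall>g\<in>G. \<forall>h\<in>G. \<forall>x\<in>V g. \<forall>y\<in>V h. br x y = - (\<epsilon> g h *\<^sub>R br y x)) \<and>
       (\<forall>g\<in>G. \<forall>h\<in>G. \<forall>k\<in>G. \<forall>x\<in>V g. \<forall>y\<in>V h. \<forall>z\<in>V k.
          \<epsilon> k g *\<^sub>R br x (br y z) + \<epsilon> g h *\<^sub>R br y (br z x) + \<epsilon> h k *\<^sub>R br z (br x y) = 0))"


section \<open>Free real vector spaces\<close>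

instantiation poly_mapping :: (type, real_vector) real_vector
begin

definition scaleR_poly_mapping :: "real \<Rightarrow> ('a \<Rightarrow>\<^sub>0 'b) \<Rightarrow> 'a \<Rightarrow>\<^sub>0 'b" where
  "scaleR_poly_mapping c p = Poly_Mapping.map (scaleR c) p"

lemma lookup_scaleR_aux:
  "Poly_Mapping.lookup (c *\<^sub>R p) k = c *\<^sub>R Poly_Mapping.lookup p k" for p :: "'a \<Rightarrow>\<^sub>0 'b"
  by (simp add: scaleR_poly_mapping_def Poly_Mapping.map.rep_eq when_def)

instance
  by standard (auto intro!: poly_mapping_eqI simp: lookup_scaleR_aux lookup_add algebra_simps)

end

lemma lookup_scaleR [simp]:
  "Poly_Mapping.lookup (c *\<^sub>R p) k = c *\<^sub>R Poly_Mapping.lookup p k"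
  for p :: "'a \<Rightarrow>\<^sub>0 'b::real_vector"
  by (rule lookup_scaleR_aux)


section \<open>The index-twisted algebra\<close>

text \<open>
  \<open>(\<int>\<^sub>2)\<^sup>m\<close> consists of the sequences \<open>\<alpha>\<close> of bits that vanish from index \<open>m\<close> on, with entries
  \<open>\<alpha> 0, \<dots>, \<alpha> (m - 1)\<close>; \<open>(\<int>\<^sub>2)\<^bsup>2m\<^esup>\<close> is written as a set of pairs. Both carry the
  componentwise addition of the ambient type.
\<close>

type_synonym bits = "nat \<Rightarrow> bit"

definition Z2_pow :: "nat \<Rightarrow> bits set" where
  "Z2_pow m = {\<alpha>. \<forall>i\<ge>m. \<alpha> i = 0}"

definition index_group :: "nat \<Rightarrow> (bits \<times> bits) set" where
  "index_group m = Z2_pow m \<times> Z2_pow m"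

definition dot :: "nat \<Rightarrow> bits \<Rightarrow> bits \<Rightarrow> bit" where
  "dot m \<alpha> \<beta> = (\<Sum>i<m. \<alpha> i * \<beta> i)"

text \<open>The sign \<open>(-1)\<^sup>b\<close> for \<open>b \<in> \<int>\<^sub>2\<close>.\<close>

definition sign_pow :: "bit \<Rightarrow> real" where
  "sign_pow b = (if b = 0 then 1 else -1)"

definition B :: "bits \<Rightarrow> bits \<Rightarrow> (bits \<times> bits) \<Rightarrow>\<^sub>0 real" where
  "B \<alpha> \<beta> = Poly_Mapping.single (\<alpha>, \<beta>) 1"

definition twisted_algebra :: "nat \<Rightarrow> ((bits \<times> bits) \<Rightarrow>\<^sub>0 real) set" where
  "twisted_algebra m = span {B \<alpha> \<beta> | \<alpha> \<beta>. (\<alpha>, \<beta>) \<in> index_group m}"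

definition twisted_mult ::
  "nat \<Rightarrow> ((bits \<times> bits) \<Rightarrow>\<^sub>0 real) \<Rightarrow> ((bits \<times> bits) \<Rightarrow>\<^sub>0 real) \<Rightarrow> ((bits \<times> bits) \<Rightarrow>\<^sub>0 real)" where
  "twisted_mult m x y =
     (\<Sum>(\<alpha>, \<beta>)\<in>Poly_Mapping.keys x. \<Sum>(\<alpha>', \<beta>')\<in>Poly_Mapping.keys y.
        (Poly_Mapping.lookup x (\<alpha>, \<beta>) * Poly_Mapping.lookup y (\<alpha>', \<beta>') * sign_pow (dot m \<beta> \<alpha>'))
          *\<^sub>R B (\<alpha> + \<alpha>') (\<beta> + \<beta>'))"

lemma twisted_mult_B:
  "twisted_mult m (B \<alpha> \<beta>) (B \<alpha>' \<beta>') = sign_pow (dot m \<beta> \<alpha>') *\<^sub>R B (\<alpha> + \<alpha>') (\<beta> + \<beta>')"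
  by (simp add: twisted_mult_def B_def)

lemma B_eq_iff: "B \<alpha> \<beta> = B \<alpha>' \<beta>' \<longleftrightarrow> \<alpha> = \<alpha>' \<and> \<beta> = \<beta>'"
proof
  assume "B \<alpha> \<beta> = B \<alpha>' \<beta>'"
  then have "Poly_Mapping.keys (B \<alpha> \<beta>) = Poly_Mapping.keys (B \<alpha>' \<beta>')" by simp
  then show "\<alpha> = \<alpha>' \<and> \<beta> = \<beta>'" by (simp add: B_def)
qed simp

lemma independent_B: "independent {B \<alpha> \<beta> | \<alpha> \<beta>. (\<alpha>, \<beta>) \<in> index_group m}"
  unfolding dependent_def
proof (intro notI, elim bexE)
  fix a
  let ?S = "{B \<alpha> \<beta> | \<alpha> \<beta>. (\<alpha>, \<beta>) \<in> index_group m}"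
  assume "a \<in> ?S" and a: "a \<in> span (?S - {a})"
  then obtain \<alpha> \<beta> where ab: "a = B \<alpha> \<beta>" by blast
  let ?T = "{x :: (bits \<times> bits) \<Rightarrow>\<^sub>0 real. Poly_Mapping.lookup x (\<alpha>, \<beta>) = 0}"
  have "subspace ?T" by (simp add: subspace_def lookup_add)
  moreover have "?S - {a} \<subseteq> ?T"
    unfolding ab by (auto simp: B_def lookup_single when_def)
  ultimately have "span (?S - {a}) \<subseteq> ?T" by (rule span_minimal[rotated])
  with a have "Poly_Mapping.lookup a (\<alpha>, \<beta>) = 0" by blast
  then show False by (simp add: ab B_def)
qed

definition component :: "bits \<times> bits \<Rightarrow> ((bits \<times> bits) \<Rightarrow>\<^sub>0 real) set" where
  "component = (\<lambda>(\<alpha>, \<beta>). span {B \<alpha> \<beta>})"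

definition \<Omega> :: "nat \<Rightarrow> bits \<times> bits \<Rightarrow> bits \<times> bits \<Rightarrow> bit" where
  "\<Omega> m = (\<lambda>(\<alpha>, \<beta>) (\<alpha>', \<beta>'). dot m \<beta> \<alpha>' + dot m \<beta>' \<alpha>)"

definition color_sign :: "nat \<Rightarrow> bits \<times> bits \<Rightarrow> bits \<times> bits \<Rightarrow> real" where
  "color_sign m g h = sign_pow (\<Omega> m g h)"

end

theory Submission
  imports Defs
begin

text \<open>
  The \<open>\<epsilon>\<close>-commutator of any graded associative algebra is a color Lie bracket as soon as
  \<open>\<epsilon>(g, h) \<epsilon>(h, g) = 1\<close>: bilinearity comes from uniqueness of the homogeneous decomposition,
  and expanding the \<open>\<epsilon>\<close>-Jacobi sum by associativity gives twelve monomials that cancel in pairs.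
  For the index-twisted algebra, \<open>\<beta>\<sqdot>\<alpha>'\<close> is biadditive in the two degrees, so the sign is a 2-cocycle,
  which gives associativity, and \<open>\<Omega>\<close> is biadditive and symmetric with values in \<open>\<int>\<^sub>2\<close>.
\<close>

section \<open>Color commutators in graded algebras\<close>

lemma decomposition_sum_superset:
  assumes "decomposition G V x f" "finite S" "{g. f g \<noteq> 0} \<subseteq> S"
  shows "x = (\<Sum>g\<in>S. f g)"
proof -
  have "x = (\<Sum>g | f g \<noteq> 0. f g)"
    using assms(1) by (simp add: decomposition_def)
  also have "\<dots> = (\<Sum>g\<in>S. f g)"
    using assms(2,3) by (intro sum.mono_neutral_left) auto
  finally show ?thesis .
qed

text \<open>Both decompositions are summed over the union of their supports, since cancellation can
  make the support of the combination smaller. Taking a = b = 1 gives additivity of homogeneous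
  parts, and b = 0 gives their homogeneity under scaling.\<close>

lemma decomposition_combine:
  assumes V: "\<And>g. g \<in> G \<Longrightarrow> subspace (V g)"
    and f: "decomposition G V x f" and f': "decomposition G V y f'"
  shows "decomposition G V (a *\<^sub>R x + b *\<^sub>R y) (\<lambda>g. a *\<^sub>R f g + b *\<^sub>R f' g)"
proof -
  let ?h = "\<lambda>g. a *\<^sub>R f g + b *\<^sub>R f' g"
  let ?S = "{g. f g \<noteq> 0} \<union> {g. f' g \<noteq> 0}"
  have fin: "finite ?S" using f f' by (simp add: decomposition_def)
  have sub: "{g. ?h g \<noteq> 0} \<subseteq> ?S" by auto
  have "a *\<^sub>R x + b *\<^sub>R y = a *\<^sub>R (\<Sum>g\<in>?S. f g) + b *\<^sub>R (\<Sum>g\<in>?S. f' g)"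
    using decomposition_sum_superset[OF f fin] decomposition_sum_superset[OF f' fin] by auto
  also have "\<dots> = (\<Sum>g\<in>?S. ?h g)"
    by (simp only: sum.distrib scaleR_sum_right)
  also have "\<dots> = (\<Sum>g | ?h g \<noteq> 0. ?h g)"
    using fin sub by (intro sum.mono_neutral_right) auto
  finally show ?thesis
    using f f' finite_subset[OF sub fin] V
    by (auto simp: decomposition_def intro!: subspace_add subspace_scale)
qed

text \<open>The setting of the general result. The condition \<open>skew\<close> is what color
  skew-symmetry requires of the signs; for values in {1, -1} it says that \<open>\<epsilon>\<close>
  is symmetric.\<close>

locale graded_algebra_with_bicharacter =
  fixes G :: "'g::ab_group_add set" and \<epsilon> :: "'g \<Rightarrow> 'g \<Rightarrow> real"
    and A :: "'v::real_vector set" and V :: "'g \<Rightarrow> 'v set" and mult :: "'v \<Rightarrow> 'v \<Rightarrow> 'v"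
  assumes graded: "graded_algebra G A V mult"
    and bichar: "bicharacter G \<epsilon>"
    and skew: "\<And>g h. g \<in> G \<Longrightarrow> h \<in> G \<Longrightarrow> \<epsilon> g h * \<epsilon> h g = 1"
begin

abbreviation "part \<equiv> homogeneous_part G V"
abbreviation "br \<equiv> color_commutator G \<epsilon> V mult"

section \<open>Rules for signs, components and products\<close>

lemma add_closed: "g \<in> G \<Longrightarrow> h \<in> G \<Longrightarrow> g + h \<in> G"
  using bichar by (simp add: bicharacter_def additive_subgroup_def)

lemma sign_sym: "g \<in> G \<Longrightarrow> h \<in> G \<Longrightarrow> \<epsilon> h g = \<epsilon> g h"
  and sign_values: "g \<in> G \<Longrightarrow> h \<in> G \<Longrightarrow> \<epsilon> g h = 1 \<or> \<epsilon> g h = -1"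
  and sign_add_right: "g \<in> G \<Longrightarrow> h \<in> G \<Longrightarrow> k \<in> G \<Longrightarrow> \<epsilon> g (h + k) = \<epsilon> g h * \<epsilon> g k"
proof -
  show val: "\<epsilon> g h = 1 \<or> \<epsilon> g h = -1" if "g \<in> G" "h \<in> G" for g h
    using bichar that by (auto simp: bicharacter_def)
  show "\<epsilon> h g = \<epsilon> g h" if "g \<in> G" "h \<in> G"
    using val[OF that] skew[OF that] by auto
  show "\<epsilon> g (h + k) = \<epsilon> g h * \<epsilon> g k" if "g \<in> G" "h \<in> G" "k \<in> G"
    using bichar that by (auto simp: bicharacter_def)
qed

lemma subspace_A: "subspace A"
  and subspace_V: "g \<in> G \<Longrightarrow> subspace (V g)"
  and V_subset: "g \<in> G \<Longrightarrow> x \<in> V g \<Longrightarrow> x \<in> A"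
  and ex1_decomposition: "x \<in> A \<Longrightarrow> \<exists>!f. decomposition G V x f"
  and mult_V: "g \<in> G \<Longrightarrow> h \<in> G \<Longrightarrow> x \<in> V g \<Longrightarrow> y \<in> V h \<Longrightarrow> mult x y \<in> V (g + h)"
  using graded by (auto simp: graded_algebra_def internal_direct_sum_def)

lemma zero_A: "0 \<in> A"
  and scale_A: "x \<in> A \<Longrightarrow> c *\<^sub>R x \<in> A"
  and add_A: "x \<in> A \<Longrightarrow> y \<in> A \<Longrightarrow> x + y \<in> A"
  and diff_A: "x \<in> A \<Longrightarrow> y \<in> A \<Longrightarrow> x - y \<in> A"
  using subspace_A by (auto simp: subspace_0 subspace_scale subspace_add subspace_diff)

lemma mult_A: "x \<in> A \<Longrightarrow> y \<in> A \<Longrightarrow> mult x y \<in> A"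
  and mult_add_left: "x \<in> A \<Longrightarrow> y \<in> A \<Longrightarrow> z \<in> A \<Longrightarrow> mult (x + y) z = mult x z + mult y z"
  and mult_add_right: "x \<in> A \<Longrightarrow> y \<in> A \<Longrightarrow> z \<in> A \<Longrightarrow> mult x (y + z) = mult x y + mult x z"
  and mult_scale_left: "x \<in> A \<Longrightarrow> y \<in> A \<Longrightarrow> mult (c *\<^sub>R x) y = c *\<^sub>R mult x y"
  and mult_scale_right: "x \<in> A \<Longrightarrow> y \<in> A \<Longrightarrow> mult x (c *\<^sub>R y) = c *\<^sub>R mult x y"
  and mult_assoc: "x \<in> A \<Longrightarrow> y \<in> A \<Longrightarrow> z \<in> A \<Longrightarrow> mult (mult x y) z = mult x (mult y z)"
  using graded by (auto simp: graded_algebra_def associative_algebra_def bilinear_on_def)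

lemma mult_zero_left: "y \<in> A \<Longrightarrow> mult 0 y = 0"
  and mult_zero_right: "y \<in> A \<Longrightarrow> mult y 0 = 0"
  using mult_scale_left[of y y 0] mult_scale_right[of y y 0] by auto

lemma mult_diff_left: "x \<in> A \<Longrightarrow> y \<in> A \<Longrightarrow> z \<in> A \<Longrightarrow> mult (x - y) z = mult x z - mult y z"
  and mult_diff_right: "x \<in> A \<Longrightarrow> y \<in> A \<Longrightarrow> z \<in> A \<Longrightarrow> mult x (y - z) = mult x y - mult x z"
  using mult_add_left[of "x - y" y z] mult_add_right[of x "y - z" z] by (simp_all add: diff_A)

section \<open>Homogeneous parts\<close>

lemma decomposition_part: "x \<in> A \<Longrightarrow> decomposition G V x (part x)"
  unfolding homogeneous_part_def by (rule theI'[OF ex1_decomposition])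

lemma part_eqI: "x \<in> A \<Longrightarrow> decomposition G V x f \<Longrightarrow> part x = f"
  using ex1_decomposition decomposition_part by blast

lemma finite_part: "x \<in> A \<Longrightarrow> finite {g. part x g \<noteq> 0}"
  using decomposition_part by (simp add: decomposition_def)

text \<open>An index outside \<open>G\<close> is harmless, because a decomposition is 0 there and 0
  lies in \<open>A\<close>.\<close>

lemma part_A: "x \<in> A \<Longrightarrow> part x g \<in> A"
  using decomposition_part[of x] V_subset[of g] zero_A
  by (cases "g \<in> G") (auto simp: decomposition_def)

lemma part_add: "x \<in> A \<Longrightarrow> y \<in> A \<Longrightarrow> part (x + y) g = part x g + part y g"
  using part_eqI[OF add_A decomposition_combine[OF subspace_V decomposition_part
        decomposition_part, where a = 1 and b = 1, simplified]] by simp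

lemma part_scale: "x \<in> A \<Longrightarrow> part (c *\<^sub>R x) g = c *\<^sub>R part x g"
  using part_eqI[OF scale_A decomposition_combine[OF subspace_V decomposition_part
        decomposition_part, where a = c and b = 0, simplified]] by simp

lemma part_homogeneous:
  assumes "g \<in> G" "x \<in> V g"
  shows "part x = (\<lambda>k. if k = g then x else 0)"
proof (rule part_eqI)
  show "x \<in> A" using assms by (rule V_subset)
  have "finite {k. (if k = g then x else 0) \<noteq> 0}"
    by (rule finite_subset[of _ "{g}"]) auto
  \<comment> \<open>For x = 0 the support is empty instead of {g}; the sum is x all the
    same.\<close>
  moreover have "(\<Sum>k | (if k = g then x else 0) \<noteq> 0. if k = g then x else 0) = x"
    by (cases "x = 0") simp_all
  ultimately show "decomposition G V x (\<lambda>k. if k = g then x else 0)"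
    using assms by (auto simp: decomposition_def subspace_0 subspace_V)
qed

section \<open>The color commutator\<close>

lemma br_eq_sum:
  assumes x: "x \<in> A" and y: "y \<in> A" and S: "finite S" "{g. part x g \<noteq> 0} \<subseteq> S"
    and T: "finite T" "{g. part y g \<noteq> 0} \<subseteq> T"
  shows "br x y = (\<Sum>g\<in>S. \<Sum>h\<in>T.
    mult (part x g) (part y h) - \<epsilon> g h *\<^sub>R mult (part y h) (part x g))"
  \<comment> \<open>Terms with a vanishing part are 0, so the supports in the definition can be
    enlarged. This lets brackets of different vectors be compared over common index sets.\<close>
  unfolding color_commutator_def Let_def using S T
  by (intro sum.mono_neutral_cong_left sum.neutral ballI)
    (auto simp: part_A x y mult_zero_left mult_zero_right)

lemma br_homogeneous:
  assumes "g \<in> G" "h \<in> G" "x \<in> V g" "y \<in> V h"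
  shows "br x y = mult x y - \<epsilon> g h *\<^sub>R mult y x"
proof -
  have "br x y = (\<Sum>g\<in>{g}. \<Sum>h\<in>{h}.
    mult (part x g) (part y h) - \<epsilon> g h *\<^sub>R mult (part y h) (part x g))"
    using assms by (intro br_eq_sum) (auto simp: part_homogeneous V_subset)
  with assms show ?thesis by (simp add: part_homogeneous)
qed

text \<open>Commutativity of the grading group puts both products x y and y x in the same
  component.\<close>

lemma br_V:
  assumes "g \<in> G" "h \<in> G" "x \<in> V g" "y \<in> V h"
  shows "br x y \<in> V (g + h)"
proof -
  have "mult y x \<in> V (g + h)"
    using mult_V[of h g y x] assms by (simp add: add.commute)
  with assms show ?thesis
    by (simp add: br_homogeneous mult_V add_closed subspace_V subspace_diff subspace_scale)
qed

lemma bilinear_br: "bilinear_on A br"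
  unfolding bilinear_on_def
proof (intro conjI ballI allI)
  show "br x y \<in> A" if "x \<in> A" "y \<in> A" for x y
    unfolding color_commutator_def Let_def using that
    by (intro subspace_sum[OF subspace_A] diff_A scale_A mult_A part_A)
next
  fix x y z assume A: "x \<in> A" "y \<in> A" "z \<in> A"
  let ?S = "{g. part x g \<noteq> 0} \<union> {g. part y g \<noteq> 0}"
  let ?S' = "{g. part y g \<noteq> 0} \<union> {g. part z g \<noteq> 0}"
  let ?X = "{g. part x g \<noteq> 0}" and ?Z = "{g. part z g \<noteq> 0}"
  have fin: "finite ?S" "finite ?S'" "finite ?X" "finite ?Z"
    by (simp_all add: finite_part A)
  \<comment> \<open>The union of the supports of x and y contains the support of x + y, so all three
    brackets become sums over the same index sets and can be added termwise.\<close>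
  have "br u z = (\<Sum>g\<in>?S. \<Sum>h\<in>?Z.
      mult (part u g) (part z h) - \<epsilon> g h *\<^sub>R mult (part z h) (part u g))"
    if "u \<in> {x, y, x + y}" for u
    using A that fin by (intro br_eq_sum) (auto simp: add_A part_add)
  then show "br (x + y) z = br x z + br y z"
    by (simp add: part_add A part_A mult_add_left mult_add_right scaleR_add_right
        flip: sum.distrib) (simp add: algebra_simps)
  have "br x u = (\<Sum>g\<in>?X. \<Sum>h\<in>?S'.
      mult (part x g) (part u h) - \<epsilon> g h *\<^sub>R mult (part u h) (part x g))"
    if "u \<in> {y, z, y + z}" for u
    using A that fin by (intro br_eq_sum) (auto simp: add_A part_add)
  then show "br x (y + z) = br x y + br x z"
    by (simp add: part_add A part_A mult_add_left mult_add_right scaleR_add_right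
        flip: sum.distrib) (simp add: algebra_simps)
next
  fix c x y assume A: "x \<in> A" "y \<in> A"
  let ?X = "{g. part x g \<noteq> 0}" and ?Y = "{g. part y g \<noteq> 0}"
  have fin: "finite ?X" "finite ?Y" by (simp_all add: finite_part A)
  \<comment> \<open>The supports of x and y still serve after scaling, even for c = 0, where the
    support of the scaled vector becomes empty.\<close>
  have "br u v = (\<Sum>g\<in>?X. \<Sum>h\<in>?Y.
      mult (part u g) (part v h) - \<epsilon> g h *\<^sub>R mult (part v h) (part u g))"
    if "u \<in> {x, c *\<^sub>R x}" "v \<in> {y, c *\<^sub>R y}" for u v
    using A that fin by (intro br_eq_sum) (auto simp: scale_A part_scale)
  then show "br (c *\<^sub>R x) y = c *\<^sub>R br x y" "br x (c *\<^sub>R y) = c *\<^sub>R br x y"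
    by (simp_all add: part_scale A part_A mult_scale_left mult_scale_right scaleR_sum_right
        scaleR_diff_right mult.commute)
qed

lemma br_skew:
  assumes "g \<in> G" "h \<in> G" "x \<in> V g" "y \<in> V h"
  shows "br x y = - (\<epsilon> g h *\<^sub>R br y x)"
  using assms by (simp add: br_homogeneous skew scaleR_diff_right)

lemma br_jacobi:
  assumes G: "g \<in> G" "h \<in> G" "k \<in> G" and V: "x \<in> V g" "y \<in> V h" "z \<in> V k"
  shows "\<epsilon> k g *\<^sub>R br x (br y z) + \<epsilon> g h *\<^sub>R br y (br z x) + \<epsilon> h k *\<^sub>R br z (br x y) = 0"
proof -
  have A: "x \<in> A" "y \<in> A" "z \<in> A" using G V by (auto intro: V_subset)
  \<comment> \<open>As [v, w] is homogeneous of degree b + c, the outer bracket carries the sign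
    \<open>\<epsilon> a (b + c)\<close>, which splits into
    \<open>\<epsilon> a b * \<epsilon> a c\<close>. Associativity then brings every product to
    right-nested form.\<close>
  have nested: "br u (br v w) =
      mult u (mult v w) - \<epsilon> b c *\<^sub>R mult u (mult w v)
      - (\<epsilon> a b * \<epsilon> a c) *\<^sub>R (mult v (mult w u) - \<epsilon> b c *\<^sub>R mult w (mult v u))"
    if "a \<in> G" "b \<in> G" "c \<in> G" "u \<in> V a" "v \<in> V b" "w \<in> V c" for a b c u v w
  proof -
    have A: "u \<in> A" "v \<in> A" "w \<in> A" using that by (auto intro: V_subset)
    have outer: "br u (br v w) = mult u (br v w) - (\<epsilon> a b * \<epsilon> a c) *\<^sub>R mult (br v w) u"
      using that by (simp add: br_homogeneous[of a "b + c"] br_V add_closed sign_add_right)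
    have inner: "br v w = mult v w - \<epsilon> b c *\<^sub>R mult w v"
      using that by (simp add: br_homogeneous)
    show ?thesis
      unfolding outer unfolding inner
      by (simp add: A mult_A scale_A mult_diff_left mult_diff_right mult_scale_left
          mult_scale_right mult_assoc)
  qed
  \<comment> \<open>By symmetry only the signs of (g, h), (h, k) and (k, g) remain. In each of their
    eight value combinations the expanded sum cancels; for example, xyz occurs with
    \<open>\<epsilon> k g\<close> in the first term and with its negative in the third.\<close>
  show ?thesis
    using sign_values[of g h] sign_values[of h k] sign_values[of k g] G
    by (auto simp: nested[OF G V] nested[of h k g y z x] nested[of k g h z x y] V
        sign_sym[of g h] sign_sym[of h k] sign_sym[of k g] algebra_simps)
qed

theorem color_lie_algebra: "color_lie_algebra G \<epsilon> A V mult"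
  unfolding color_lie_algebra_def Let_def
  using graded bichar bilinear_br br_skew br_jacobi by blast

end

section \<open>The index-twisted algebra\<close>

lemma single_eq_0_iff: "Poly_Mapping.single g c = 0 \<longleftrightarrow> c = 0"
  by (metis lookup_single_eq lookup_zero single_zero)

lemma sum_single_lookup:
  fixes x :: "'a \<Rightarrow>\<^sub>0 'b::comm_monoid_add"
  shows "(\<Sum>g\<in>Poly_Mapping.keys x. Poly_Mapping.single g (Poly_Mapping.lookup x g)) = x"
  by (rule poly_mapping_eqI) (simp add: lookup_sum lookup_single when_def in_keys_iff)

text \<open>Reduces an identity that is additive in an argument to multiples of basis vectors. The
  coefficient is part of the base case, so no separate step for scaling arises.\<close>

lemma poly_mapping_single_induct [case_names single add]:
  fixes x :: "'a \<Rightarrow>\<^sub>0 'b::comm_monoid_add"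
  assumes single: "\<And>g c. P (Poly_Mapping.single g c)"
    and add: "\<And>x y. P x \<Longrightarrow> P y \<Longrightarrow> P (x + y)"
  shows "P x"
proof -
  have "P (\<Sum>g\<in>K. Poly_Mapping.single g (Poly_Mapping.lookup x g))" if "finite K" for K
    using that
  proof (induction K)
    case empty
    \<comment> \<open>The zero vector is a basis vector with coefficient 0.\<close>
    show ?case using single[of _ 0] by simp
  qed (simp add: single add)
  from this[OF finite_keys, of x] show ?thesis by (simp only: sum_single_lookup)
qed

lemma span_single:
  "span ((\<lambda>g. Poly_Mapping.single g (1::real)) ` S) = {x. Poly_Mapping.keys x \<subseteq> S}"
    (is "span ?B = ?K")
proof
  have "?K = {x. \<forall>g. g \<notin> S \<longrightarrow> Poly_Mapping.lookup x g = 0}"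
    by (auto simp: in_keys_iff)
  then have "subspace ?K"
    by (simp add: subspace_def lookup_add)
  then show "span ?B \<subseteq> ?K"
    by (intro span_minimal) auto
  show "?K \<subseteq> span ?B"
  proof
    fix x :: "'a \<Rightarrow>\<^sub>0 real" assume x: "x \<in> ?K"
    have "c *\<^sub>R Poly_Mapping.single g 1 = Poly_Mapping.single g c" for g :: 'a and c :: real
      by (rule poly_mapping_eqI) (simp add: lookup_single when_def)
    then have "x = (\<Sum>g\<in>Poly_Mapping.keys x.
        Poly_Mapping.lookup x g *\<^sub>R Poly_Mapping.single g 1)"
      by (simp only: sum_single_lookup)
    also have "\<dots> \<in> span ?B"
      using x by (intro span_sum span_scale span_base) auto
    finally show "x \<in> span ?B" .
  qed
qed

section \<open>The algebra and its components as conditions on supports\<close>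

lemma twisted_algebra_eq: "twisted_algebra m = {x. Poly_Mapping.keys x \<subseteq> index_group m}"
proof -
  have "{B \<alpha> \<beta> | \<alpha> \<beta>. (\<alpha>, \<beta>) \<in> index_group m} =
      (\<lambda>g. Poly_Mapping.single g 1) ` index_group m"
    by (auto simp: B_def)
  then show ?thesis by (simp add: twisted_algebra_def span_single)
qed

lemma component_eq: "component g = {x. Poly_Mapping.keys x \<subseteq> {g}}"
  using span_single[of "{g}"] by (cases g) (simp add: component_def B_def)

lemma component_iff: "x \<in> component g \<longleftrightarrow> (\<exists>c. x = Poly_Mapping.single g c)"
proof
  assume x: "x \<in> component g"
  have "x = Poly_Mapping.single g (Poly_Mapping.lookup x g)"
    using x by (intro poly_mapping_eqI)
      (auto simp: component_eq lookup_single when_def in_keys_iff subset_iff)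
  then show "\<exists>c. x = Poly_Mapping.single g c" by blast
qed (auto simp: component_eq split: if_splits)

lemma dim_component: "dim (component g) = 1"
proof (cases g)
  case (Pair \<alpha> \<beta>)
  have "B \<alpha> \<beta> \<noteq> 0" by (simp add: B_def single_eq_0_iff)
  then show ?thesis
    using dim_eq_card_independent[of "{B \<alpha> \<beta>}"] by (simp add: Pair component_def)
qed

section \<open>The index group, the pairing of bit sequences and signs\<close>

lemma additive_subgroup_index_group: "additive_subgroup (index_group m)"
  by (auto simp: additive_subgroup_def index_group_def Z2_pow_def zero_prod_def)

lemma dot_add_left: "dot m (\<alpha> + \<alpha>') \<beta> = dot m \<alpha> \<beta> + dot m \<alpha>' \<beta>"
  and dot_add_right: "dot m \<alpha> (\<beta> + \<beta>') = dot m \<alpha> \<beta> + dot m \<alpha> \<beta>'"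
  unfolding dot_def plus_fun_apply
  by (simp_all only: distrib_left distrib_right sum.distrib)

lemma sign_pow_add: "sign_pow (a + b) = sign_pow a * sign_pow b"
  by (cases a; cases b) (simp_all add: sign_pow_def)

lemma sign_pow_square: "sign_pow a * sign_pow a = 1"
  by (simp add: sign_pow_def)

section \<open>The twisted multiplication\<close>

lemma twisted_mult_eq_sum:
  assumes "finite S" "Poly_Mapping.keys x \<subseteq> S" "finite T" "Poly_Mapping.keys y \<subseteq> T"
  shows "twisted_mult m x y = (\<Sum>g\<in>S. \<Sum>h\<in>T.
    (Poly_Mapping.lookup x g * Poly_Mapping.lookup y h * sign_pow (dot m (snd g) (fst h)))
      *\<^sub>R Poly_Mapping.single (g + h) 1)"
  \<comment> \<open>Outside the supports a coefficient is 0, so any finite supersets may index the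
    double sum. Bilinearity then reduces to calculating over common index sets.\<close>
  unfolding twisted_mult_def case_prod_beta prod.collapse
  using assms
  by (intro sum.mono_neutral_cong_left sum.neutral ballI)
    (auto simp: B_def in_keys_iff plus_prod_def)

lemma twisted_mult_single:
  "twisted_mult m (Poly_Mapping.single g a) (Poly_Mapping.single h b) =
     Poly_Mapping.single (g + h) (a * b * sign_pow (dot m (snd g) (fst h)))"
  by (subst twisted_mult_eq_sum[of "{g}" _ "{h}"])
    (auto intro!: poly_mapping_eqI simp: lookup_single when_def)

lemma twisted_mult_add_left: "twisted_mult m (x + y) z = twisted_mult m x z + twisted_mult m y z"
proof -
  let ?S = "Poly_Mapping.keys x \<union> Poly_Mapping.keys y"
  show ?thesis
    using Poly_Mapping.keys_add[of x y]
    by (simp add: twisted_mult_eq_sum[of ?S _ "Poly_Mapping.keys z"] lookup_add algebra_simps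
        sum.distrib)
qed

lemma twisted_mult_add_right: "twisted_mult m x (y + z) = twisted_mult m x y + twisted_mult m x z"
proof -
  let ?S = "Poly_Mapping.keys y \<union> Poly_Mapping.keys z"
  show ?thesis
    using Poly_Mapping.keys_add[of y z]
    by (simp add: twisted_mult_eq_sum[of "Poly_Mapping.keys x" _ ?S] lookup_add algebra_simps
        sum.distrib)
qed

lemma twisted_mult_scale:
  "twisted_mult m (c *\<^sub>R x) y = c *\<^sub>R twisted_mult m x y"
  "twisted_mult m x (c *\<^sub>R y) = c *\<^sub>R twisted_mult m x y"
proof -
  \<comment> \<open>Only an inclusion holds, since c = 0 empties the support.\<close>
  have keys: "Poly_Mapping.keys (c *\<^sub>R z) \<subseteq> Poly_Mapping.keys z"
    for z :: "bits \<times> bits \<Rightarrow>\<^sub>0 real"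
    by (auto simp: in_keys_iff)
  show "twisted_mult m (c *\<^sub>R x) y = c *\<^sub>R twisted_mult m x y"
    "twisted_mult m x (c *\<^sub>R y) = c *\<^sub>R twisted_mult m x y"
    using keys[of x] keys[of y]
    by (simp_all add: twisted_mult_eq_sum[of "Poly_Mapping.keys x" _ "Poly_Mapping.keys y"]
        scaleR_sum_right algebra_simps)
qed

text \<open>Both sides are additive in each argument, which leaves multiples of basis vectors. There
  the sign exponent is \<beta>.\<alpha>' + \<beta>.\<alpha>'' + \<beta>'.\<alpha>'' for either
  bracketing, by biadditivity of the pairing.\<close>

lemma twisted_mult_assoc:
  "twisted_mult m (twisted_mult m x y) z = twisted_mult m x (twisted_mult m y z)"
proof (induction x rule: poly_mapping_single_induct)
  case (single g a)
  show ?case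
  proof (induction y rule: poly_mapping_single_induct)
    case (single h b)
    show ?case
    proof (induction z rule: poly_mapping_single_induct)
      case (single k c)
      show ?case
        by (simp only: twisted_mult_single fst_add snd_add dot_add_left dot_add_right
            sign_pow_add add.assoc mult_ac)
    qed (simp add: twisted_mult_add_right)
  qed (simp add: twisted_mult_add_left twisted_mult_add_right)
qed (simp add: twisted_mult_add_left)

lemma twisted_mult_component:
  "x \<in> component g \<Longrightarrow> y \<in> component h \<Longrightarrow> twisted_mult m x y \<in> component (g + h)"
  by (auto simp: component_iff twisted_mult_single)

lemma twisted_mult_closed:
  assumes "x \<in> twisted_algebra m" "y \<in> twisted_algebra m"
  shows "twisted_mult m x y \<in> twisted_algebra m"
proof -
  have "Poly_Mapping.single (g + h) 1 \<in> twisted_algebra m"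
    if "g \<in> Poly_Mapping.keys x" "h \<in> Poly_Mapping.keys y" for g h
    using additive_subgroup_index_group[of m] that assms
    by (auto simp: twisted_algebra_eq additive_subgroup_def)
  then show ?thesis
    unfolding twisted_mult_eq_sum[OF finite_keys subset_refl finite_keys subset_refl]
      twisted_algebra_def
    by (intro span_sum span_scale)
qed

lemma associative_twisted_algebra:
  "associative_algebra (twisted_algebra m) (twisted_mult m)"
  unfolding associative_algebra_def bilinear_on_def
  by (simp add: twisted_mult_closed twisted_mult_add_left twisted_mult_add_right
      twisted_mult_scale twisted_mult_assoc) (simp add: twisted_algebra_def)

section \<open>The grading by the index group\<close>

lemma decomposition_component_iff:
  assumes "x \<in> twisted_algebra m"
  shows "decomposition (index_group m) component x f \<longleftrightarrow>
    f = (\<lambda>g. Poly_Mapping.single g (Poly_Mapping.lookup x g))"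
proof
  assume f: "decomposition (index_group m) component x f"
  \<comment> \<open>Outside the index group f g is 0, which still lies in
    \<open>component g\<close>; hence the claim holds for every g.\<close>
  have comp: "f g \<in> component g" for g
    using f by (cases "g \<in> index_group m") (simp_all add: decomposition_def component_eq del: split_paired_All)
  show "f = (\<lambda>g. Poly_Mapping.single g (Poly_Mapping.lookup x g))"
  proof
    fix g
    obtain c where c: "f g = Poly_Mapping.single g c"
      using comp component_iff by blast
    have fin: "finite {g. f g \<noteq> 0}" and x: "x = (\<Sum>g | f g \<noteq> 0. f g)"
      using f by (auto simp: decomposition_def)
    \<comment> \<open>Only the summand of index g contributes to the coefficient at g, so x
      determines f g. This gives uniqueness.\<close>
    have "Poly_Mapping.lookup (f h) g = (if h = g then c else 0)" for h
      using comp[of h] c by (auto simp: component_iff lookup_single when_def)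
    then have "Poly_Mapping.lookup x g = (\<Sum>h | f h \<noteq> 0. if h = g then c else 0)"
      by (subst x) (simp only: lookup_sum)
    also have "\<dots> = c"
      \<comment> \<open>If g is not in the support of f, the sum is 0, and so is c.\<close>
      using fin c by (simp add: single_eq_0_iff)
    finally have "Poly_Mapping.lookup x g = c" .
    with c show "f g = Poly_Mapping.single g (Poly_Mapping.lookup x g)" by simp
  qed
next
  assume f: "f = (\<lambda>g. Poly_Mapping.single g (Poly_Mapping.lookup x g))"
  have supp: "{g. f g \<noteq> 0} = Poly_Mapping.keys x"
    by (auto simp: f in_keys_iff single_eq_0_iff)
  have "x = (\<Sum>g\<in>Poly_Mapping.keys x. f g)"
    by (simp only: f sum_single_lookup)
  moreover have "f g = 0" if "g \<notin> index_group m" for g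
    using assms that supp by (auto simp: twisted_algebra_eq)
  ultimately show "decomposition (index_group m) component x f"
    by (auto simp: decomposition_def supp) (auto simp: f component_iff)
qed

lemma graded_twisted_algebra:
  "graded_algebra (index_group m) (twisted_algebra m) component (twisted_mult m)"
proof -
  have "internal_direct_sum (index_group m) component (twisted_algebra m)"
    unfolding internal_direct_sum_def
  proof (intro conjI ballI)
    show "subspace (twisted_algebra m)" by (simp add: twisted_algebra_def)
    show "subspace (component g)" for g by (cases g) (simp add: component_def)
    show "component g \<subseteq> twisted_algebra m" if "g \<in> index_group m" for g
      using that by (auto simp: component_eq twisted_algebra_eq)
    show "\<exists>!f. decomposition (index_group m) component x f" if "x \<in> twisted_algebra m" for x
      using that by (simp add: decomposition_component_iff)
  qed
  then show ?thesis
    by (simp add: graded_algebra_def additive_subgroup_index_group associative_twisted_algebra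
        twisted_mult_component)
qed

section \<open>The color sign and the conclusion\<close>

lemma bicharacter_color_sign: "bicharacter (index_group m) (color_sign m)"
  unfolding bicharacter_def color_sign_def \<Omega>_def
  using additive_subgroup_index_group[of m]
  by (auto simp: dot_add_left dot_add_right sign_pow_add sign_pow_def)

text \<open>Exchanging the arguments of \<open>\<Omega>\<close> only swaps its two summands, so the
  product is the square of a sign.\<close>

lemma color_sign_skew: "color_sign m g h * color_sign m h g = 1"
  proof -
  have "\<Omega> m h g = \<Omega> m g h" by (cases g; cases h) (simp only: \<Omega>_def case_prod_conv add.commute)
  then show ?thesis by (simp add: color_sign_def sign_pow_square)
qed

theorem theorem8p3:
  fixes m :: nat
  shows "(graded_algebra (index_group m) (twisted_algebra m) component (twisted_mult m) \<and>
           (\<forall>g\<in>index_group m. dim (component g) = 1)) \<and>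
         bicharacter (index_group m) (color_sign m) \<and>
         ((\<forall>g\<in>index_group m. \<forall>h\<in>index_group m. \<forall>X\<in>component g. \<forall>Y\<in>component h.
             color_commutator (index_group m) (color_sign m) component (twisted_mult m) X Y =
               twisted_mult m X Y - color_sign m g h *\<^sub>R twisted_mult m Y X) \<and>
          color_lie_algebra (index_group m) (color_sign m) (twisted_algebra m) component
            (twisted_mult m))"
proof -
  interpret graded_algebra_with_bicharacter "index_group m" "color_sign m" "twisted_algebra m"
    component "twisted_mult m"
    by unfold_locales (simp_all add: graded_twisted_algebra bicharacter_color_sign color_sign_skew)
  show ?thesis
    \<comment> \<open>\<open>br_homogeneous\<close> shows that the bilinear extension has the
      prescribed values on homogeneous elements.\<close>
    using graded bichar dim_component br_homogeneous color_lie_algebra by blast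
qed

end
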